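(* Let $G$ be a topological group that is amenable but not Tychonoff. Then $G$ does not admit a universal irreducible conic representation.
   Context: Topological linear spaces (real or complex) are Hausdorff. A cone $V$ is a subset of a topological linear space with point-separating continuous dual such that $ax+by\in V$ for all $x,y\in V$, $a,b\ge 0$. A section of $V$ is a set $L^{-1}(1)$, where $L:V\to\mathbb{R}_{\ge 0}$ is continuous, preserves non-negative linear combinations, and is strictly positive on $V\setminus\{0\}$. A ray of $V$ is a set $\{\lambda x:\lambda>0\}$ with $0\ne x\in V$. A conic representation $(V,\tau)$ of $G$ consists of a non-zero cone $V$ admitting a compact section and a continuous action $\tau:G\times V\to V$ such that each $\tau_g$ preserves non-negative linear combinations. It is irreducible if $V$ has no closed non-zero $G$-invariant sub-cone other than $V$. A homomorphism of conic representations is a continuous $G$-equivariant map that preserves non-negative linear combinations and does not vanish at any non-zero point. A universal irreducible conic representation of $G$ is an irreducible conic representation admitting a homomorphism to every irreducible conic representation of $G$. An affine representation of $G$ is a non-empty compact convex set $Q$ in a topological linear space with point-separating continuous dual, with a continuous action $\rho:G\times Q\to Q$ such that each $\rho_g$ preserves convex combinations. $G$ is amenable if every affine representation of $G$ has a fixed point. $G$ is Tychonoff if every conic representation of $G$ has a $G$-invariant ray. *)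

theory Defs
  imports "HOL-Analysis.Analysis"
begin

text \<open>
  Topological groups are types of class \<open>topological_group_add\<close>; this class is not commutative
  (nor Hausdorff), only its notation is additive: \<open>g + h\<close> is the product and \<open>0\<close> the unit.

  A topological linear space is a topology \<open>T\<close> whose underlying set \<open>topspace T\<close> is a linear
  subspace of a type \<open>'v::real_vector\<close>.  The type \<open>'v\<close> carries no topology; it is only
  a supply of vectors. Quantifying over \<open>T\<close> therefore means quantifying over all topological linear
  spaces whose underlying vector space embeds linearly into \<open>'v\<close>.  Since HOL has no quantifier
  over types inside formulas, notions that refer to all topological linear spaces take such a
  type as an argument.  Every topological linear space is of this form for a suitable \<open>'v\<close>,
  so an unrestricted "for all representations" implies the relative one for each type, and an
  unrestricted "there is a representation" provides a type for which the relative one holds.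

  Scalars are real. A complex space is covered through its underlying real space: cones,
  convexity and continuity do not change, and the complex continuous dual separates
  points if and only if the real one does, by taking real parts.
\<close>

definition topological_linear_space :: "'v::real_vector topology \<Rightarrow> bool" where
  "topological_linear_space T \<longleftrightarrow>
     subspace (topspace T) \<and> Hausdorff_space T \<and>
     continuous_map (prod_topology T T) T (\<lambda>(x, y). x + y) \<and>
     continuous_map (prod_topology euclideanreal T) T (\<lambda>(c, x). c *\<^sub>R x)"

definition continuous_dual :: "'v::real_vector topology \<Rightarrow> ('v \<Rightarrow> real) set" where
  "continuous_dual T = {f. continuous_map T euclideanreal f \<and>
     (\<forall>x\<in>topspace T. \<forall>y\<in>topspace T. f (x + y) = f x + f y) \<and>
     (\<forall>c. \<forall>x\<in>topspace T. f (c *\<^sub>R x) = c * f x)}"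

definition point_separating_dual :: "'v::real_vector topology \<Rightarrow> bool" where
  "point_separating_dual T \<longleftrightarrow>
     (\<forall>x\<in>topspace T. \<forall>y\<in>topspace T. x \<noteq> y \<longrightarrow> (\<exists>f\<in>continuous_dual T. f x \<noteq> f y))"

definition preserves_nonneg_combinations ::
    "'v::real_vector set \<Rightarrow> ('v \<Rightarrow> 'w::real_vector) \<Rightarrow> bool" where
  "preserves_nonneg_combinations V f \<longleftrightarrow>
     (\<forall>x\<in>V. \<forall>y\<in>V. \<forall>a\<ge>0. \<forall>b\<ge>0. f (a *\<^sub>R x + b *\<^sub>R y) = a *\<^sub>R f x + b *\<^sub>R f y)"

definition preserves_convex_combinations ::
    "'v::real_vector set \<Rightarrow> ('v \<Rightarrow> 'w::real_vector) \<Rightarrow> bool" where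
  "preserves_convex_combinations Q f \<longleftrightarrow>
     (\<forall>x\<in>Q. \<forall>y\<in>Q. \<forall>a\<ge>0. \<forall>b\<ge>0. a + b = 1 \<longrightarrow>
        f (a *\<^sub>R x + b *\<^sub>R y) = a *\<^sub>R f x + b *\<^sub>R f y)"

definition linear_cone :: "'v::real_vector topology \<Rightarrow> 'v set \<Rightarrow> bool" where
  "linear_cone T V \<longleftrightarrow>
     topological_linear_space T \<and> point_separating_dual T \<and> V \<subseteq> topspace T \<and>
     (\<forall>x\<in>V. \<forall>y\<in>V. \<forall>a\<ge>0. \<forall>b\<ge>0. a *\<^sub>R x + b *\<^sub>R y \<in> V)"

definition nonzero_cone :: "'v::real_vector topology \<Rightarrow> 'v set \<Rightarrow> bool" where
  "nonzero_cone T V \<longleftrightarrow> linear_cone T V \<and> (\<exists>x\<in>V. x \<noteq> 0)"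

definition cone_section :: "'v::real_vector topology \<Rightarrow> 'v set \<Rightarrow> 'v set \<Rightarrow> bool" where
  "cone_section T V K \<longleftrightarrow>
     (\<exists>L :: 'v \<Rightarrow> real.
        continuous_map (subtopology T V) euclideanreal L \<and>
        preserves_nonneg_combinations V L \<and>
        (\<forall>x\<in>V. 0 \<le> L x) \<and> (\<forall>x\<in>V - {0}. 0 < L x) \<and>
        K = {x\<in>V. L x = 1})"

definition cone_ray :: "'v::real_vector set \<Rightarrow> 'v set \<Rightarrow> bool" where
  "cone_ray V R \<longleftrightarrow> (\<exists>x\<in>V. x \<noteq> 0 \<and> R = {c *\<^sub>R x |c. 0 < c})"

definition continuous_action ::
    "'v topology \<Rightarrow> 'v set \<Rightarrow> ('g::topological_group_add \<Rightarrow> 'v \<Rightarrow> 'v) \<Rightarrow> bool" where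
  "continuous_action T X \<alpha> \<longleftrightarrow>
     (\<forall>x\<in>X. \<alpha> 0 x = x) \<and>
     (\<forall>g h. \<forall>x\<in>X. \<alpha> (g + h) x = \<alpha> g (\<alpha> h x)) \<and>
     continuous_map (prod_topology euclidean (subtopology T X)) (subtopology T X)
       (\<lambda>(g, x). \<alpha> g x)"

definition invariant_under :: "('g \<Rightarrow> 'v \<Rightarrow> 'v) \<Rightarrow> 'v set \<Rightarrow> bool" where
  "invariant_under \<alpha> A \<longleftrightarrow> (\<forall>g. \<alpha> g ` A \<subseteq> A)"

definition conic_representation ::
    "'v::real_vector topology \<Rightarrow> 'v set \<Rightarrow> ('g::topological_group_add \<Rightarrow> 'v \<Rightarrow> 'v) \<Rightarrow> bool" where
  "conic_representation T V \<tau> \<longleftrightarrow>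
     nonzero_cone T V \<and> (\<exists>K. cone_section T V K \<and> compactin T K) \<and>
     continuous_action T V \<tau> \<and> (\<forall>g. preserves_nonneg_combinations V (\<tau> g))"

definition irreducible_conic_representation ::
    "'v::real_vector topology \<Rightarrow> 'v set \<Rightarrow> ('g::topological_group_add \<Rightarrow> 'v \<Rightarrow> 'v) \<Rightarrow> bool" where
  "irreducible_conic_representation T V \<tau> \<longleftrightarrow>
     conic_representation T V \<tau> \<and>
     (\<forall>W. W \<subseteq> V \<and> nonzero_cone T W \<and> closedin (subtopology T V) W \<and> invariant_under \<tau> W
        \<longrightarrow> W = V)"

definition conic_homomorphism ::
    "'v::real_vector topology \<Rightarrow> 'v set \<Rightarrow> ('g \<Rightarrow> 'v \<Rightarrow> 'v) \<Rightarrow>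
     'w::real_vector topology \<Rightarrow> 'w set \<Rightarrow> ('g \<Rightarrow> 'w \<Rightarrow> 'w) \<Rightarrow> ('v \<Rightarrow> 'w) \<Rightarrow> bool" where
  "conic_homomorphism S V \<sigma> T W \<tau> f \<longleftrightarrow>
     continuous_map (subtopology S V) (subtopology T W) f \<and>
     (\<forall>g. \<forall>x\<in>V. f (\<sigma> g x) = \<tau> g (f x)) \<and>
     preserves_nonneg_combinations V f \<and>
     (\<forall>x\<in>V. x \<noteq> 0 \<longrightarrow> f x \<noteq> 0)"

text \<open>The target representations range over the topological linear spaces in \<open>'w\<close>.\<close>

definition universal_irreducible_conic_representation ::
    "'w::real_vector itself \<Rightarrow>
     'v::real_vector topology \<Rightarrow> 'v set \<Rightarrow> ('g::topological_group_add \<Rightarrow> 'v \<Rightarrow> 'v) \<Rightarrow> bool" where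
  "universal_irreducible_conic_representation U S V \<sigma> \<longleftrightarrow>
     irreducible_conic_representation S V \<sigma> \<and>
     (\<forall>(T :: 'w topology) W \<tau>. irreducible_conic_representation T W \<tau> \<longrightarrow>
        (\<exists>f. conic_homomorphism S V \<sigma> T W \<tau> f))"

definition affine_representation ::
    "'v::real_vector topology \<Rightarrow> 'v set \<Rightarrow> ('g::topological_group_add \<Rightarrow> 'v \<Rightarrow> 'v) \<Rightarrow> bool" where
  "affine_representation T Q \<rho> \<longleftrightarrow>
     topological_linear_space T \<and> point_separating_dual T \<and>
     Q \<noteq> {} \<and> compactin T Q \<and> convex Q \<and>
     continuous_action T Q \<rho> \<and> (\<forall>g. preserves_convex_combinations Q (\<rho> g))"

definition amenable :: "'g::topological_group_add itself \<Rightarrow> 'v::real_vector itself \<Rightarrow> bool" where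
  "amenable G U \<longleftrightarrow>
     (\<forall>(T :: 'v topology) Q (\<rho> :: 'g \<Rightarrow> 'v \<Rightarrow> 'v). affine_representation T Q \<rho> \<longrightarrow>
        (\<exists>x\<in>Q. \<forall>g. \<rho> g x = x))"

definition tychonoff :: "'g::topological_group_add itself \<Rightarrow> 'v::real_vector itself \<Rightarrow> bool" where
  "tychonoff G U \<longleftrightarrow>
     (\<forall>(T :: 'v topology) V (\<tau> :: 'g \<Rightarrow> 'v \<Rightarrow> 'v). conic_representation T V \<tau> \<longrightarrow>
        (\<exists>R. cone_ray V R \<and> invariant_under \<tau> R))"

end

theory Submission
  imports Defs
begin

text \<open>
  The half-line with trivial action is an irreducible conic representation, so a universal
  irreducible conic representation carries an invariant continuous functional that is strictly
  positive away from the origin.  The corresponding section is an invariant compact convex set, in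
  which amenability provides a fixed point.  Its image under any homomorphism spans an invariant
  ray, so every irreducible conic representation has an invariant ray.  By Zorn's lemma every
  conic representation contains an irreducible one, so the group would be Tychonoff.
\<close>

section \<open>Cones and sections\<close>

lemma preserves_nonneg_combinations_scaleR:
  assumes "preserves_nonneg_combinations V f" "x \<in> V" "0 \<le> a"
  shows "f (a *\<^sub>R x) = a *\<^sub>R f x"
proof -
  have "f (a *\<^sub>R x + 0 *\<^sub>R x) = a *\<^sub>R f x + 0 *\<^sub>R f x"
    using assms unfolding preserves_nonneg_combinations_def by blast
  then show ?thesis by simp
qed

lemma preserves_nonneg_combinations_subset:
  "preserves_nonneg_combinations V f \<Longrightarrow> W \<subseteq> V \<Longrightarrow> preserves_nonneg_combinations W f"
  unfolding preserves_nonneg_combinations_def by blast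

lemma linear_cone_scaleR:
  assumes "linear_cone T V" "x \<in> V" "0 \<le> a"
  shows "a *\<^sub>R x \<in> V"
proof -
  have "a *\<^sub>R x + 0 *\<^sub>R x \<in> V"
    using assms unfolding linear_cone_def by blast
  then show ?thesis by simp
qed

lemma linear_cone_subsetI:
  assumes "linear_cone T V" "W \<subseteq> V"
    and "\<And>x y a b. x \<in> W \<Longrightarrow> y \<in> W \<Longrightarrow> 0 \<le> a \<Longrightarrow> 0 \<le> b \<Longrightarrow> a *\<^sub>R x + b *\<^sub>R y \<in> W"
  shows "linear_cone T W"
  using assms unfolding linear_cone_def by (meson order_trans)

text \<open>A section is recorded in \<open>cone_section\<close> only as a level set. Naming its
  functional lets it be restricted to sub-cones, pulled back along homomorphisms and compared with
  other functionals.\<close>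

definition positive_functional :: "'v::real_vector topology \<Rightarrow> 'v set \<Rightarrow> ('v \<Rightarrow> real) \<Rightarrow> bool" where
  "positive_functional T V L \<longleftrightarrow>
     continuous_map (subtopology T V) euclideanreal L \<and> preserves_nonneg_combinations V L \<and>
     (\<forall>x\<in>V. 0 \<le> L x) \<and> (\<forall>x\<in>V - {0}. 0 < L x)"

lemma cone_section_iff:
  "cone_section T V K \<longleftrightarrow> (\<exists>L. positive_functional T V L \<and> K = {x\<in>V. L x = 1})"
  unfolding cone_section_def positive_functional_def by simp

lemma positive_functional_subset:
  assumes "positive_functional T V L" "W \<subseteq> V"
  shows "positive_functional T W L"
  using assms preserves_nonneg_combinations_subset continuous_map_from_subtopology_mono
  unfolding positive_functional_def by (metis DiffD1 DiffD2 DiffI subsetD)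

text \<open>Homogeneity with factor 0 gives \<open>L 0 = 0\<close>. Hence every other positive
  functional is strictly positive on the section of \<open>L\<close> and may be divided by
  there.\<close>

lemma positive_functional_nonzero:
  assumes "linear_cone T V" "positive_functional T V L" "x \<in> V" "L x = 1"
  shows "x \<noteq> 0"
  using assms preserves_nonneg_combinations_scaleR[of V L x 0]
  unfolding positive_functional_def by auto

text \<open>Every ray of the cone meets the section. This trades non-zero points for points of a set
  on which compactness can be used.\<close>

lemma positive_functional_normalize:
  assumes "linear_cone T V" "positive_functional T V L" "x \<in> V" "x \<noteq> 0"
  shows "(1 / L x) *\<^sub>R x \<in> {x\<in>V. L x = 1}"
proof -
  have "0 < L x" "preserves_nonneg_combinations V L"
    using assms unfolding positive_functional_def by auto
  then show ?thesis
    using linear_cone_scaleR[OF assms(1,3), of "1 / L x"] assms(3)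
      preserves_nonneg_combinations_scaleR[of V L x "1 / L x"] by simp
qed

text \<open>The sections of \<open>L\<close> and \<open>M\<close> correspond to each other by radial projection.\<close>

lemma compactin_section_change:
  assumes cone: "linear_cone T V" and L: "positive_functional T V L"
    and M: "positive_functional T V M" and K: "compactin T {x\<in>V. L x = 1}"
  shows "compactin T {x\<in>V. M x = 1}"
proof -
  let ?K = "{x\<in>V. L x = 1}" and ?h = "\<lambda>x. (1 / M x) *\<^sub>R x"
  have pos: "0 < M x" if "x \<in> ?K" for x
    using that positive_functional_nonzero[OF cone L] M unfolding positive_functional_def by auto
  have "continuous_map (subtopology T ?K) euclideanreal M"
    using M unfolding positive_functional_def
    by (auto intro: continuous_map_from_subtopology_mono)
  then have "continuous_map (subtopology T ?K) euclideanreal (\<lambda>x. 1 / M x)"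
    using pos by (intro continuous_map_real_divide) (auto simp: less_le)
  \<comment> \<open>The radial projection \<open>?h\<close> is joint scalar multiplication composed
    with x -> (1 / M x, x).\<close>
  then have pair: "continuous_map (subtopology T ?K) (prod_topology euclideanreal T) (\<lambda>x. (1 / M x, x))"
    by (auto simp: continuous_map_paired intro: continuous_map_from_subtopology)
  have "continuous_map (prod_topology euclideanreal T) T (\<lambda>(c, x). c *\<^sub>R x)"
    using cone unfolding linear_cone_def topological_linear_space_def by auto
  from continuous_map_compose[OF pair this] have "continuous_map (subtopology T ?K) T ?h"
    by (simp add: o_def)
  moreover have "compactin (subtopology T ?K) ?K"
    using K by (simp add: compactin_subtopology)
  ultimately have "compactin T (?h ` ?K)"
    by (rule image_compactin[rotated])
  moreover have "?h ` ?K = {x\<in>V. M x = 1}"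
  proof
    show "?h ` ?K \<subseteq> {x\<in>V. M x = 1}"
      using positive_functional_normalize[OF cone M] positive_functional_nonzero[OF cone L] by auto
    show "{x\<in>V. M x = 1} \<subseteq> ?h ` ?K"
    proof
      fix x assume x: "x \<in> {x\<in>V. M x = 1}"
      then have "x \<noteq> 0" "x \<in> V" using positive_functional_nonzero[OF cone M] by auto
      then have Lx: "0 < L x" using L unfolding positive_functional_def by auto
      \<comment> \<open>Since \<open>M x = 1\<close>, normalizing by \<open>M\<close> exactly undoes
        the normalization of x by \<open>L\<close>, so x is the projection of a point of
        \<open>?K\<close>.\<close>
      have "M ((1 / L x) *\<^sub>R x) = 1 / L x"
        using preserves_nonneg_combinations_scaleR[of V M x "1 / L x"] M x Lx
        unfolding positive_functional_def by auto
      then have "x = ?h ((1 / L x) *\<^sub>R x)" using Lx by simp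
      then show "x \<in> ?h ` ?K"
        using positive_functional_normalize[OF cone L \<open>x \<in> V\<close> \<open>x \<noteq> 0\<close>] by (rule image_eqI)
    qed
  qed
  ultimately show ?thesis by simp
qed

lemma conic_representation_iff:
  "conic_representation T V \<tau> \<longleftrightarrow>
     nonzero_cone T V \<and> (\<exists>L. positive_functional T V L \<and> compactin T {x\<in>V. L x = 1}) \<and>
     continuous_action T V \<tau> \<and> (\<forall>g. preserves_nonneg_combinations V (\<tau> g))"
  unfolding conic_representation_def cone_section_iff by blast

lemma continuous_action_subset:
  assumes "continuous_action T V \<tau>" "W \<subseteq> V" "invariant_under \<tau> W"
  shows "continuous_action T W \<tau>"
proof -
  have "continuous_map (prod_topology euclidean (subtopology T V)) T (\<lambda>(g, x). \<tau> g x)"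
    using assms(1) unfolding continuous_action_def
    by (auto dest: continuous_map_into_fulltopology)
  then have "continuous_map
      (subtopology (prod_topology euclidean (subtopology T V)) (UNIV \<times> W)) T (\<lambda>(g, x). \<tau> g x)"
    by (rule continuous_map_from_subtopology)
  \<comment> \<open>Joint continuity on W is a restriction of joint continuity on V, once
    restricting the product is identified with restricting its second factor.\<close>
  moreover have "subtopology (prod_topology euclidean (subtopology T V)) (UNIV \<times> W)
      = prod_topology (euclidean :: 'b topology) (subtopology T W)"
    using assms(2) by (simp add: subtopology_Times subtopology_subtopology Int_absorb1)
  ultimately have "continuous_map (prod_topology euclidean (subtopology T W)) (subtopology T W)
      (\<lambda>(g, x). \<tau> g x)"
    using assms(3) unfolding invariant_under_def
    by (intro continuous_map_into_subtopology) auto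
  then show ?thesis
    using assms(1,2) unfolding continuous_action_def by blast
qed

section \<open>Irreducible subrepresentations\<close>

text \<open>These are the sub-cones tested in the definition of irreducibility, collected into a set
  so that Zorn's lemma can be applied to it. A compact section is not demanded, because it is
  inherited from V.\<close>

definition subrepresentations ::
    "'v::real_vector topology \<Rightarrow> 'v set \<Rightarrow> ('g \<Rightarrow> 'v \<Rightarrow> 'v) \<Rightarrow> 'v set set" where
  "subrepresentations T V \<tau> =
     {W. W \<subseteq> V \<and> nonzero_cone T W \<and> closedin (subtopology T V) W \<and> invariant_under \<tau> W}"

lemma subrepresentations_refl:
  assumes "conic_representation T V \<tau>"
  shows "V \<in> subrepresentations T V \<tau>"
proof -
  have "V \<subseteq> topspace T"
    using assms unfolding conic_representation_def nonzero_cone_def linear_cone_def by auto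
  then have V: "topspace (subtopology T V) = V" by auto
  \<comment> \<open>The invariance of V is hidden in the codomain of the continuous action
    map.\<close>
  have "(\<lambda>(g, x). \<tau> g x) \<in> topspace (prod_topology euclidean (subtopology T V)) \<rightarrow> V"
    using assms V unfolding conic_representation_def continuous_action_def continuous_map_def
    by metis
  then have "\<tau> g x \<in> V" if "x \<in> V" for g x
    using that V by (auto dest: Pi_mem[where x = "(g, x)"])
  then show ?thesis
    using assms V closedin_topspace[of "subtopology T V"]
    unfolding subrepresentations_def conic_representation_def invariant_under_def by auto
qed

text \<open>Closed in W and W closed in V gives closed in V. Thus a minimal element for V has no
  smaller competitor of its own.\<close>

lemma subrepresentations_trans:
  assumes "W \<in> subrepresentations T V \<tau>" "X \<in> subrepresentations T W \<tau>"
  shows "X \<in> subrepresentations T V \<tau>"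
proof -
  have "closedin (subtopology (subtopology T V) W) X"
    using assms unfolding subrepresentations_def by (simp add: subtopology_subtopology Int_absorb1)
  then have "closedin (subtopology T V) X"
    using assms closedin_trans_full unfolding subrepresentations_def by blast
  then show ?thesis
    using assms unfolding subrepresentations_def by blast
qed

text \<open>The section of W is the section of V cut by a relatively closed set, hence
  compact.\<close>

lemma conic_representation_subrepresentation:
  assumes rep: "conic_representation T V \<tau>" and W: "W \<in> subrepresentations T V \<tau>"
  shows "conic_representation T W \<tau>"
proof -
  obtain L where L: "positive_functional T V L" "compactin T {x\<in>V. L x = 1}"
    using rep unfolding conic_representation_iff by blast
  have WV: "W \<subseteq> V" and cl: "closedin (subtopology T V) W"
    using W unfolding subrepresentations_def by auto
  have "compactin (subtopology T V) {x\<in>V. L x = 1}"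
    using L by (auto simp: compactin_subtopology)
  then have "compactin (subtopology T V) (W \<inter> {x\<in>V. L x = 1})"
    using cl by (rule closed_Int_compactin[rotated])
  moreover have "W \<inter> {x\<in>V. L x = 1} = {x\<in>W. L x = 1}" using WV by auto
  ultimately have "compactin T {x\<in>W. L x = 1}" by (simp add: compactin_subtopology)
  then show ?thesis
    using rep W positive_functional_subset[OF L(1) WV] continuous_action_subset[OF _ WV]
      preserves_nonneg_combinations_subset[OF _ WV]
    unfolding conic_representation_iff subrepresentations_def by blast
qed

text \<open>Compactness keeps the intersection from shrinking to the origin: all members of the
  chain meet the compact section, finite intersections are again members, and the finite
  intersection property yields a common point on the section, which is non-zero.\<close>

lemma subrepresentations_Inter_chain:
  assumes rep: "conic_representation T V \<tau>" and "\<C> \<noteq> {}"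
    and chain: "subset.chain (subrepresentations T V \<tau>) \<C>"
  shows "\<Inter>\<C> \<in> subrepresentations T V \<tau>"
proof -
  obtain L where L: "positive_functional T V L" "compactin T {x\<in>V. L x = 1}"
    using rep unfolding conic_representation_iff by blast
  let ?K = "{x\<in>V. L x = 1}"
  have cone: "linear_cone T V"
    using rep unfolding conic_representation_def nonzero_cone_def by auto
  have sub: "W \<subseteq> V" "linear_cone T W" "\<exists>x\<in>W. x \<noteq> 0" "closedin (subtopology T V) W"
      "invariant_under \<tau> W" if "W \<in> \<C>" for W
    using chain that unfolding subset_chain_def subrepresentations_def nonzero_cone_def by blast+
  have meet: "?K \<inter> W \<noteq> {}" if W: "W \<in> \<C>" for W
  proof -
    obtain x where "x \<in> W" "x \<noteq> 0" using sub(3) W by blast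
    then show ?thesis
      using positive_functional_normalize[OF sub(2) positive_functional_subset[OF L(1) sub(1)]]
        sub(1) W by blast
  qed
  have K: "compactin (subtopology T V) ?K"
    using L by (auto simp: compactin_subtopology)
  have fip: "?K \<inter> \<Inter>\<F> \<noteq> {}" if "finite \<F>" "\<F> \<subseteq> \<C>" for \<F>
  proof (cases "\<F> = {}")
    \<comment> \<open>The empty intersection is \<open>UNIV\<close>, so it remains to see that
      \<open>?K\<close> is non-empty, which follows from any member of the chain.\<close>
    case True
    then show ?thesis using meet \<open>\<C> \<noteq> {}\<close> by auto
  next
    case False
    have "subset.chain (subrepresentations T V \<tau>) \<F>"
      using chain that(2) unfolding subset_chain_def by blast
    then show ?thesis using Inter_in_chain[OF that(1) False] that(2) meet by blast
  qed
  have "(\<forall>C\<in>\<C>. closedin (subtopology T V) C) \<and>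
      (\<forall>\<F>. finite \<F> \<and> \<F> \<subseteq> \<C> \<longrightarrow> ?K \<inter> \<Inter>\<F> \<noteq> {})"
    using sub(4) fip by blast
  then have "?K \<inter> \<Inter>\<C> \<noteq> {}"
    using K unfolding compactin_fip by blast
  then obtain x where "x \<in> \<Inter>\<C>" "x \<noteq> 0"
    using positive_functional_nonzero[OF cone L(1)] by blast
  moreover have "\<Inter>\<C> \<subseteq> V" using sub(1) \<open>\<C> \<noteq> {}\<close> by blast
  moreover from this have "linear_cone T (\<Inter>\<C>)"
  proof (rule linear_cone_subsetI[OF cone], intro InterI)
    fix x y W and a b :: real
    assume "x \<in> \<Inter>\<C>" "y \<in> \<Inter>\<C>" "0 \<le> a" "0 \<le> b" and W: "W \<in> \<C>"
    then have "x \<in> W" "y \<in> W" "0 \<le> a" "0 \<le> b" by auto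
    then show "a *\<^sub>R x + b *\<^sub>R y \<in> W"
      using sub(2)[OF W] unfolding linear_cone_def by simp
  qed
  moreover have "closedin (subtopology T V) (\<Inter>\<C>)"
    using sub(4) \<open>\<C> \<noteq> {}\<close> by blast
  moreover have "invariant_under \<tau> (\<Inter>\<C>)"
    using sub(5) unfolding invariant_under_def by blast
  ultimately show ?thesis
    unfolding subrepresentations_def nonzero_cone_def by blast
qed

lemma ex_irreducible_subrepresentation:
  assumes rep: "conic_representation T V \<tau>"
  shows "\<exists>W\<subseteq>V. irreducible_conic_representation T W \<tau>"
proof -
  let ?A = "subrepresentations T V \<tau>"
  have "\<exists>W\<in>?A. \<forall>X\<in>?A. X \<subseteq> W \<longrightarrow> X = W"
  proof (rule predicate_Zorn)
    \<comment> \<open>Inclusion is reversed, so that maximal elements for Zorn's lemma are minimal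
      sub-cones; the empty chain is bounded by V.\<close>
    show "partial_order_on ?A (relation_of (\<lambda>X Y. Y \<subseteq> X) ?A)"
      by (rule partial_order_on_relation_ofI) auto
  next
    fix \<C> assume "\<C> \<in> Chains (relation_of (\<lambda>X Y. Y \<subseteq> X) ?A)"
    then have "subset.chain ?A \<C>"
      unfolding Chains_def relation_of_def subset_chain_def by blast
    then show "\<exists>U\<in>?A. \<forall>X\<in>\<C>. U \<subseteq> X"
      using subrepresentations_refl[OF rep] subrepresentations_Inter_chain[OF rep]
      by (cases "\<C> = {}") blast+
  qed
  then obtain W where W: "W \<in> ?A" and min: "\<And>X. X \<in> ?A \<Longrightarrow> X \<subseteq> W \<Longrightarrow> X = W" by blast
  have "X = W" if "X \<in> subrepresentations T W \<tau>" for X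
    using min subrepresentations_trans[OF W that] that unfolding subrepresentations_def by blast
  then have "irreducible_conic_representation T W \<tau>"
    using conic_representation_subrepresentation[OF rep W]
    unfolding irreducible_conic_representation_def subrepresentations_def by blast
  then show ?thesis using W unfolding subrepresentations_def by blast
qed

section \<open>The trivial representation\<close>

text \<open>Building the half-line inside a given cone supplies its topology, separating dual and
  positive functional, and keeps it in the same vector type. A non-zero sub-cone contains a positive
  multiple of w, hence the whole half-line.\<close>

lemma irreducible_trivial_halfline:
  assumes rep: "conic_representation T V (\<tau> :: 'g::topological_group_add \<Rightarrow> 'v::real_vector \<Rightarrow> 'v)"
    and w: "w \<in> V" "w \<noteq> 0"
  shows "irreducible_conic_representation T {c *\<^sub>R w |c. 0 \<le> c} (\<lambda>g :: 'g. id)"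
proof -
  let ?W = "{c *\<^sub>R w |c. 0 \<le> c}"
  obtain L where L: "positive_functional T V L"
    using rep unfolding conic_representation_iff by blast
  have cone: "linear_cone T V"
    using rep unfolding conic_representation_def nonzero_cone_def by auto
  have WV: "?W \<subseteq> V" using linear_cone_scaleR[OF cone w(1)] by auto
  have coneW: "linear_cone T ?W"
  proof (rule linear_cone_subsetI[OF cone WV])
    fix x y and a b :: real
    assume xy: "x \<in> ?W" "y \<in> ?W" and ab: "0 \<le> a" "0 \<le> b"
    obtain c d where "x = c *\<^sub>R w" "y = d *\<^sub>R w" "0 \<le> c" "0 \<le> d" using xy by blast
    then have "a *\<^sub>R x + b *\<^sub>R y = (a * c + b * d) *\<^sub>R w" "0 \<le> a * c + b * d"
      using ab by (auto simp: scaleR_add_left)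
    then show "a *\<^sub>R x + b *\<^sub>R y \<in> ?W" by blast
  qed
  have wW: "w \<in> ?W" by (intro CollectI exI[of _ 1]) simp
  have LW: "positive_functional T ?W L" using positive_functional_subset[OF L WV] .
  have Lw: "0 < L w" using L w unfolding positive_functional_def by auto
  \<comment> \<open>The section is a single point, which makes it compact.\<close>
  have sec: "{x\<in>?W. L x = 1} = {(1 / L w) *\<^sub>R w}"
  proof
    show "{(1 / L w) *\<^sub>R w} \<subseteq> {x\<in>?W. L x = 1}"
      using positive_functional_normalize[OF coneW LW wW w(2)] by blast
    show "{x\<in>?W. L x = 1} \<subseteq> {(1 / L w) *\<^sub>R w}"
    proof
      fix x assume "x \<in> {x\<in>?W. L x = 1}"
      then obtain c where c: "x = c *\<^sub>R w" "0 \<le> c" "L (c *\<^sub>R w) = 1" by blast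
      then have "c * L w = 1"
        using preserves_nonneg_combinations_scaleR[of V L w c] L w
        unfolding positive_functional_def by simp
      then show "x \<in> {(1 / L w) *\<^sub>R w}" using c Lw by (simp add: field_simps)
    qed
  qed
  have "{x\<in>?W. L x = 1} \<subseteq> topspace T"
    using coneW unfolding linear_cone_def by blast
  then have "compactin T {x\<in>?W. L x = 1}"
    unfolding sec by (intro finite_imp_compactin) auto
  moreover have "continuous_action T ?W (\<lambda>g :: 'g. id)"
    unfolding continuous_action_def
    using continuous_map_snd[of euclidean "subtopology T ?W"] by (simp add: case_prod_beta')
  moreover have "preserves_nonneg_combinations ?W id"
    unfolding preserves_nonneg_combinations_def by simp
  ultimately have "conic_representation T ?W (\<lambda>g :: 'g. id)"
    unfolding conic_representation_iff nonzero_cone_def using coneW LW w(2) wW by blast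
  moreover have "X = ?W" if X: "X \<subseteq> ?W" "nonzero_cone T X" for X
  proof -
    obtain c where c: "c *\<^sub>R w \<in> X" "0 < c"
      using X unfolding nonzero_cone_def by force
    have "d *\<^sub>R w \<in> X" if "0 \<le> d" for d
      using linear_cone_scaleR[of T X "c *\<^sub>R w" "d / c"] X c that
      unfolding nonzero_cone_def by simp
    then show ?thesis using X(1) by blast
  qed
  ultimately show ?thesis unfolding irreducible_conic_representation_def by blast
qed

section \<open>Fixed points and invariant rays\<close>

lemma conic_homomorphism_in:
  assumes "conic_homomorphism S V \<sigma> T W \<tau> f" "V \<subseteq> topspace S" "x \<in> V"
  shows "f x \<in> W"
proof -
  have "f \<in> topspace (subtopology S V) \<rightarrow> topspace (subtopology T W)"
    using assms(1) unfolding conic_homomorphism_def by (simp add: continuous_map_def)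
  then show ?thesis using assms(2,3) by auto
qed

text \<open>Strict positivity survives the pullback because homomorphisms do not vanish at non-zero
  points.\<close>

lemma positive_functional_conic_homomorphism:
  assumes f: "conic_homomorphism S V \<sigma> T W \<tau> f" and V: "V \<subseteq> topspace S"
    and L: "positive_functional T W L"
  shows "positive_functional S V (L \<circ> f)"
proof -
  have fW: "f x \<in> W" if "x \<in> V" for x using conic_homomorphism_in[OF f V that] .
  have "continuous_map (subtopology S V) euclideanreal (L \<circ> f)"
    using f L unfolding conic_homomorphism_def positive_functional_def
    by (auto intro: continuous_map_compose)
  then show ?thesis
    using f L fW
    unfolding conic_homomorphism_def positive_functional_def preserves_nonneg_combinations_def
    by auto
qed

text \<open>Invariance of M makes its section an invariant convex set. The compact section provided
  by the representation may belong to another functional; \<open>compactin_section_change\<close>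
  carries compactness over to M.\<close>

lemma amenable_fixed_point:
  assumes am: "amenable TYPE('g::topological_group_add) TYPE('v::real_vector)"
    and rep: "conic_representation S V (\<sigma> :: 'g \<Rightarrow> 'v \<Rightarrow> 'v)"
    and M: "positive_functional S V M"
    and inv: "\<And>g x. x \<in> V \<Longrightarrow> M (\<sigma> g x) = M x"
  shows "\<exists>x\<in>V. x \<noteq> 0 \<and> (\<forall>g. \<sigma> g x = x)"
proof -
  let ?Q = "{x\<in>V. M x = 1}"
  have cone: "linear_cone S V" and "\<exists>x\<in>V. x \<noteq> 0"
    using rep unfolding conic_representation_def nonzero_cone_def by auto
  then have ne: "?Q \<noteq> {}" using positive_functional_normalize[OF cone M] by blast
  have comp: "compactin S ?Q"
    using rep compactin_section_change[OF cone _ M] unfolding conic_representation_iff by blast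
  have conv: "convex ?Q"
    using cone M
    unfolding convex_def linear_cone_def positive_functional_def preserves_nonneg_combinations_def
    by auto
  have "invariant_under \<sigma> V"
    using subrepresentations_refl[OF rep] unfolding subrepresentations_def by blast
  then have "invariant_under \<sigma> ?Q"
    using inv unfolding invariant_under_def by auto
  then have act: "continuous_action S ?Q \<sigma>"
    using rep unfolding conic_representation_def by (auto intro: continuous_action_subset)
  have "\<forall>g. preserves_convex_combinations ?Q (\<sigma> g)"
    using rep
    unfolding conic_representation_def preserves_nonneg_combinations_def
      preserves_convex_combinations_def by blast
  then have "affine_representation S ?Q \<sigma>"
    using cone ne comp conv act unfolding affine_representation_def linear_cone_def by blast
  then obtain x where "x \<in> ?Q" "\<forall>g. \<sigma> g x = x"
    using am unfolding amenable_def by blast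
  then show ?thesis using positive_functional_nonzero[OF cone M] by blast
qed

lemma invariant_ray_of_fixed_point:
  assumes "\<And>g. preserves_nonneg_combinations V (\<tau> g)" "x \<in> V" "x \<noteq> 0" "\<And>g. \<tau> g x = x"
  shows "\<exists>R. cone_ray V R \<and> invariant_under \<tau> R"
proof (intro exI conjI)
  show "cone_ray V {c *\<^sub>R x |c. 0 < c}"
    using assms unfolding cone_ray_def by blast
  have "\<tau> g (c *\<^sub>R x) = c *\<^sub>R x" if "0 < c" for g c
    using preserves_nonneg_combinations_scaleR[OF assms(1,2), of c g] assms(4) that by simp
  then show "invariant_under \<tau> {c *\<^sub>R x |c. 0 < c}"
    unfolding invariant_under_def by auto
qed

text \<open>Amenability is applied only to a section in the space of the universal representation,
  of type \<open>'v\<close>; the failure of the Tychonoff property and both targets of universality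
  live in \<open>'w\<close>.\<close>

theorem theorem25:
  assumes "amenable TYPE('g::topological_group_add) TYPE('v::real_vector)"
    and "\<not> tychonoff TYPE('g) TYPE('w::real_vector)"
  shows "\<not> (\<exists>(S :: 'v topology) V (\<sigma> :: 'g \<Rightarrow> 'v \<Rightarrow> 'v).
            universal_irreducible_conic_representation TYPE('w) S V \<sigma>)"
proof (rule notI, elim exE)
  fix S :: "'v topology" and V and \<sigma> :: "'g \<Rightarrow> 'v \<Rightarrow> 'v"
  assume U: "universal_irreducible_conic_representation TYPE('w) S V \<sigma>"
  have rep: "conic_representation S V \<sigma>"
    using U unfolding universal_irreducible_conic_representation_def
      irreducible_conic_representation_def by simp
  have univ: "\<exists>f. conic_homomorphism S V \<sigma> T W \<tau> f"
    if "irreducible_conic_representation T W \<tau>" for T :: "'w topology" and W \<tau>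
    using U that unfolding universal_irreducible_conic_representation_def by simp
  have V: "V \<subseteq> topspace S"
    using rep unfolding conic_representation_def nonzero_cone_def linear_cone_def by blast
  obtain T :: "'w topology" and C and \<tau> :: "'g \<Rightarrow> 'w \<Rightarrow> 'w"
    where C: "conic_representation T C \<tau>" "\<nexists>R. cone_ray C R \<and> invariant_under \<tau> R"
    using assms(2) unfolding tychonoff_def by blast
  obtain W where WC: "W \<subseteq> C" and irr: "irreducible_conic_representation T W \<tau>"
    using ex_irreducible_subrepresentation[OF C(1)] by blast
  have W: "conic_representation T W \<tau>"
    using irr unfolding irreducible_conic_representation_def by blast
  \<comment> \<open>Any non-zero vector of W serves; its half-line lies in the type
    \<open>'w\<close> over which universality ranges.\<close>
  obtain w where w: "w \<in> W" "w \<noteq> 0"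
    using W unfolding conic_representation_def nonzero_cone_def by blast
  have triv: "irreducible_conic_representation T {c *\<^sub>R w |c. 0 \<le> c} (\<lambda>g :: 'g. id)"
    using irreducible_trivial_halfline[OF W w] .
  obtain p where p: "conic_homomorphism S V \<sigma> T {c *\<^sub>R w |c. 0 \<le> c} (\<lambda>g. id) p"
    using univ[OF triv] by blast
  obtain L where L: "positive_functional T {c *\<^sub>R w |c. 0 \<le> c} L"
    using triv unfolding irreducible_conic_representation_def conic_representation_iff by blast
  \<comment> \<open>The target of p carries the trivial action, so equivariance of p is
    invariance.\<close>
  have "(L \<circ> p) (\<sigma> g x) = (L \<circ> p) x" if "x \<in> V" for g x
    using p that unfolding conic_homomorphism_def by simp
  then obtain x where x: "x \<in> V" "x \<noteq> 0" "\<And>g. \<sigma> g x = x"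
    using amenable_fixed_point[OF assms(1) rep positive_functional_conic_homomorphism[OF p V L]]
    by blast
  obtain f where f: "conic_homomorphism S V \<sigma> T W \<tau> f"
    using univ[OF irr] by blast
  \<comment> \<open>The image of the fixed point is fixed, non-zero and in C, so its ray contradicts
    the choice of C.\<close>
  have "f x \<in> C" using conic_homomorphism_in[OF f V x(1)] WC by blast
  moreover have "f x \<noteq> 0" using f x unfolding conic_homomorphism_def by blast
  moreover have "\<tau> g (f x) = f x" for g
    using f x unfolding conic_homomorphism_def by metis
  ultimately have "\<exists>R. cone_ray C R \<and> invariant_under \<tau> R"
    using C(1) unfolding conic_representation_def by (intro invariant_ray_of_fixed_point) auto
  then show False using C(2) by blast
qed

end
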